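(* For a finite positive MV-algebra $\mathbf A$, the following are equivalent: (1) $\mathbf A$ is subdirectly irreducible; (2) $\mathbf A\cong\text{\L}_n^+$ for some $n\in\mathbb N\setminus\{0\}$; (3) $\mathbf A$ is nontrivial, totally ordered and, for all $x,y\in A$, either $x\oplus y=1$ or $x\odot y=0$.
   Context: Every MV-algebra $\langle A,\oplus,\neg,0\rangle$ has term-definable operations $1:=\neg 0$, $x\odot y:=\neg(\neg x\oplus\neg y)$, $x\vee y:=(x\odot\neg y)\oplus y$, $x\wedge y:=\neg(\neg x\vee\neg y)$. A positive MV-algebra is a $\{\vee,\wedge,\oplus,\odot,0,1\}$-subreduct of an MV-algebra (i.e., an algebra isomorphic to a subalgebra of the $\{\vee,\wedge,\oplus,\odot,0,1\}$-reduct of an MV-algebra). Subdirect irreducibility is understood in the absolute sense of universal algebra, for algebras in the signature $\{\vee,\wedge,\oplus,\odot,0,1\}$ (the identity congruence is completely meet irreducible in the lattice of all congruences; in particular the trivial algebra is not subdirectly irreducible). For $n\in\mathbb N\setminus\{0\}$, $\text{\L}_n^+$ is the algebra with universe $\{0,\frac1n,\dots,\frac{n-1}n,1\}$, with $\vee=\max$, $\wedge=\min$, $x\oplus y=\min\{x+y,1\}$, $x\odot y=\max\{x+y-1,0\}$ and constants $0,1$. *)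

theory Defs
  imports Complex_Main "HOL-Algebra.Congruence"
begin

record 'a mv = "'a partial_object" +
  mv_plus :: "'a \<Rightarrow> 'a \<Rightarrow> 'a"  (infixl \<open>\<oplus>\<^sub>m\<index>\<close> 65)
  mv_neg :: "'a \<Rightarrow> 'a"  (\<open>\<sim>\<index> _\<close> [81] 80)
  mv_zero :: 'a  (\<open>\<zero>\<^sub>m\<index>\<close>)

locale mv_algebra =
  fixes M :: "('a, 'b) mv_scheme" (structure)
  assumes zero_closed: "\<zero>\<^sub>m \<in> carrier M"
    and neg_closed: "x \<in> carrier M \<Longrightarrow> \<sim> x \<in> carrier M"
    and plus_closed: "\<lbrakk>x \<in> carrier M; y \<in> carrier M\<rbrakk> \<Longrightarrow> x \<oplus>\<^sub>m y \<in> carrier M"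
    and plus_assoc: "\<lbrakk>x \<in> carrier M; y \<in> carrier M; z \<in> carrier M\<rbrakk>
          \<Longrightarrow> (x \<oplus>\<^sub>m y) \<oplus>\<^sub>m z = x \<oplus>\<^sub>m (y \<oplus>\<^sub>m z)"
    and plus_comm: "\<lbrakk>x \<in> carrier M; y \<in> carrier M\<rbrakk> \<Longrightarrow> x \<oplus>\<^sub>m y = y \<oplus>\<^sub>m x"
    and plus_zero: "x \<in> carrier M \<Longrightarrow> x \<oplus>\<^sub>m \<zero>\<^sub>m = x"
    and neg_neg: "x \<in> carrier M \<Longrightarrow> \<sim> (\<sim> x) = x"
    and plus_one: "x \<in> carrier M \<Longrightarrow> x \<oplus>\<^sub>m (\<sim> \<zero>\<^sub>m) = \<sim> \<zero>\<^sub>m"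
    and lukasiewicz: "\<lbrakk>x \<in> carrier M; y \<in> carrier M\<rbrakk>
          \<Longrightarrow> \<sim> (\<sim> x \<oplus>\<^sub>m y) \<oplus>\<^sub>m y = \<sim> (\<sim> y \<oplus>\<^sub>m x) \<oplus>\<^sub>m x"

definition mv_one :: "('a, 'b) mv_scheme \<Rightarrow> 'a" where
  "mv_one M = mv_neg M (mv_zero M)"

definition mv_times :: "('a, 'b) mv_scheme \<Rightarrow> 'a \<Rightarrow> 'a \<Rightarrow> 'a" where
  "mv_times M x y = mv_neg M (mv_plus M (mv_neg M x) (mv_neg M y))"

definition mv_join :: "('a, 'b) mv_scheme \<Rightarrow> 'a \<Rightarrow> 'a \<Rightarrow> 'a" where
  "mv_join M x y = mv_plus M (mv_times M x (mv_neg M y)) y"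

definition mv_meet :: "('a, 'b) mv_scheme \<Rightarrow> 'a \<Rightarrow> 'a \<Rightarrow> 'a" where
  "mv_meet M x y = mv_neg M (mv_join M (mv_neg M x) (mv_neg M y))"

record 'a pmv = "'a partial_object" +
  p_join :: "'a \<Rightarrow> 'a \<Rightarrow> 'a"  (infixl \<open>\<squnion>\<^sub>p\<index>\<close> 65)
  p_meet :: "'a \<Rightarrow> 'a \<Rightarrow> 'a"  (infixl \<open>\<sqinter>\<^sub>p\<index>\<close> 70)
  p_plus :: "'a \<Rightarrow> 'a \<Rightarrow> 'a"  (infixl \<open>\<oplus>\<^sub>p\<index>\<close> 65)
  p_times :: "'a \<Rightarrow> 'a \<Rightarrow> 'a"  (infixl \<open>\<odot>\<^sub>p\<index>\<close> 70)
  p_zero :: 'a  (\<open>\<zero>\<^sub>p\<index>\<close>)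
  p_one :: 'a  (\<open>\<one>\<^sub>p\<index>\<close>)

definition pmv_subuniverse :: "'a set \<Rightarrow> 'a pmv \<Rightarrow> bool" where
  "pmv_subuniverse S A \<longleftrightarrow> S \<subseteq> carrier A \<and> p_zero A \<in> S \<and> p_one A \<in> S \<and>
     (\<forall>x\<in>S. \<forall>y\<in>S. p_join A x y \<in> S \<and> p_meet A x y \<in> S \<and> p_plus A x y \<in> S \<and> p_times A x y \<in> S)"

text \<open>The fields of a record are functions on the whole type, so being an algebra is the
  requirement that the carrier be closed under them.\<close>

definition pmv_structure :: "'a pmv \<Rightarrow> bool" where
  "pmv_structure A \<longleftrightarrow> pmv_subuniverse (carrier A) A"

definition pmv_iso :: "'a pmv \<Rightarrow> 'b pmv \<Rightarrow> ('a \<Rightarrow> 'b) set" where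
  "pmv_iso A B = {h. bij_betw h (carrier A) (carrier B) \<and>
     h (p_zero A) = p_zero B \<and> h (p_one A) = p_one B \<and>
     (\<forall>x\<in>carrier A. \<forall>y\<in>carrier A.
        h (p_join A x y) = p_join B (h x) (h y) \<and>
        h (p_meet A x y) = p_meet B (h x) (h y) \<and>
        h (p_plus A x y) = p_plus B (h x) (h y) \<and>
        h (p_times A x y) = p_times B (h x) (h y))}"

definition pmv_isomorphic :: "'a pmv \<Rightarrow> 'b pmv \<Rightarrow> bool" where
  "pmv_isomorphic A B \<longleftrightarrow> pmv_iso A B \<noteq> {}"

definition positive_reduct :: "'a mv \<Rightarrow> 'a pmv" where
  "positive_reduct M = \<lparr>carrier = carrier M, p_join = mv_join M, p_meet = mv_meet M,
     p_plus = mv_plus M, p_times = mv_times M, p_zero = mv_zero M, p_one = mv_one M\<rparr>"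

text \<open>HOL cannot quantify existentially over the type of elements of the ambient MV-algebra,
  so that type is an explicit parameter. In an assumption it becomes a free type variable,
  i.e. the MV-algebra may live on any type whatsoever.\<close>

definition positive_mv_algebra :: "'b itself \<Rightarrow> 'a pmv \<Rightarrow> bool" where
  "positive_mv_algebra (_ :: 'b itself) A \<longleftrightarrow> pmv_structure A \<and>
     (\<exists>(M :: 'b mv) S. mv_algebra M \<and> pmv_subuniverse S (positive_reduct M) \<and>
        pmv_isomorphic A ((positive_reduct M)\<lparr>carrier := S\<rparr>))"

definition pmv_congruence :: "'a pmv \<Rightarrow> ('a \<times> 'a) set \<Rightarrow> bool" where
  "pmv_congruence A \<theta> \<longleftrightarrow> equiv (carrier A) \<theta> \<and>
     (\<forall>(x, x') \<in> \<theta>. \<forall>(y, y') \<in> \<theta>.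
        (p_join A x y, p_join A x' y') \<in> \<theta> \<and>
        (p_meet A x y, p_meet A x' y') \<in> \<theta> \<and>
        (p_plus A x y, p_plus A x' y') \<in> \<theta> \<and>
        (p_times A x y, p_times A x' y') \<in> \<theta>)"

text \<open>Complete meet irreducibility of the identity in the lattice of congruences. The meet of a
  family of congruences is its intersection, where the empty family has meet
  \<open>carrier A \<times> carrier A\<close>; hence the trivial algebra is not subdirectly irreducible.\<close>

definition pmv_subdirectly_irreducible :: "'a pmv \<Rightarrow> bool" where
  "pmv_subdirectly_irreducible A \<longleftrightarrow>
     (\<forall>\<Theta>. (\<forall>\<theta>\<in>\<Theta>. pmv_congruence A \<theta>) \<and>
           (carrier A \<times> carrier A) \<inter> \<Inter>\<Theta> = Id_on (carrier A)
           \<longrightarrow> Id_on (carrier A) \<in> \<Theta>)"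

definition pmv_le :: "'a pmv \<Rightarrow> 'a \<Rightarrow> 'a \<Rightarrow> bool" where
  "pmv_le A x y \<longleftrightarrow> p_meet A x y = x"

definition pmv_totally_ordered :: "'a pmv \<Rightarrow> bool" where
  "pmv_totally_ordered A \<longleftrightarrow> (\<forall>x\<in>carrier A. \<forall>y\<in>carrier A. pmv_le A x y \<or> pmv_le A y x)"

definition pmv_nontrivial :: "'a pmv \<Rightarrow> bool" where
  "pmv_nontrivial A \<longleftrightarrow> (\<exists>x\<in>carrier A. \<exists>y\<in>carrier A. x \<noteq> y)"

definition luk_plus :: "nat \<Rightarrow> real pmv" where
  "luk_plus n = \<lparr>carrier = {real k / real n | k. k \<le> n}, p_join = max, p_meet = min,
     p_plus = (\<lambda>x y. min (x + y) 1), p_times = (\<lambda>x y. max (x + y - 1) 0),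
     p_zero = 0, p_one = 1\<rparr>"

end

theory Submission
  imports Defs
begin

text \<open>Regard the finite algebra as a subreduct \<open>S\<close> of an MV-algebra. If \<open>u \<and> v = 0\<close>, then the
  congruences on \<open>S\<close> induced by the ideals generated by \<open>u\<close> and by \<open>v\<close> meet in the identity, so
  for subdirectly irreducible \<open>S\<close> one of them is the identity. With \<open>u = x \<odot> \<not> y\<close> and
  \<open>v = y \<odot> \<not> x\<close> this makes \<open>x\<close> and \<open>y\<close> comparable; replacing \<open>y\<close> by \<open>\<not> y\<close> it gives
  \<open>x \<odot> y = 0\<close> or \<open>x \<oplus> y = 1\<close>. Conversely, let \<open>S\<close> be a finite nontrivial chain with this
  dichotomy. Its only idempotents are 0 and 1, so multiples of the least nonzero element \<open>a\<close>
  reach 1 and powers of the greatest element \<open>c\<close> below 1 reach 0. Hence \<open>a \<odot> c = 0\<close> and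
  \<open>a \<oplus> c = 1\<close>, that is \<open>c = \<not> a\<close>; therefore \<open>S\<close> is closed under subtracting \<open>a\<close> and consists
  of the multiples of \<open>a\<close>.\<close>

text \<open>Condition (3) of the theorem as a single predicate, so that it can be carried along
  isomorphisms.\<close>

definition luk_chain :: "'a pmv \<Rightarrow> bool" where
  "luk_chain A \<longleftrightarrow> pmv_nontrivial A \<and> pmv_totally_ordered A \<and>
     (\<forall>x\<in>carrier A. \<forall>y\<in>carrier A. p_plus A x y = p_one A \<or> p_times A x y = p_zero A)"

lemma pmv_subdirectly_irreducibleD:
  assumes "pmv_subdirectly_irreducible A" "\<forall>\<theta>\<in>\<Theta>. pmv_congruence A \<theta>"
    and "carrier A \<times> carrier A \<inter> \<Inter>\<Theta> = Id_on (carrier A)"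
  shows "Id_on (carrier A) \<in> \<Theta>"
  using assms by (simp add: pmv_subdirectly_irreducible_def)

subsection \<open>Arithmetic of MV-algebras\<close>

context mv_algebra
begin

abbreviation one (\<open>\<one>\<^sub>m\<close>) where "\<one>\<^sub>m \<equiv> mv_one M"

abbreviation times (infixl \<open>\<odot>\<^sub>m\<close> 70) where "x \<odot>\<^sub>m y \<equiv> mv_times M x y"

text \<open>The natural order, encoded through the Lukasiewicz implication
  \<open>\<sim> x \<oplus> y\<close>; being an equation, it is open to rewriting with the
  axioms.\<close>

definition le (infix \<open>\<sqsubseteq>\<close> 50) where "x \<sqsubseteq> y \<longleftrightarrow> \<sim> x \<oplus>\<^sub>m y = \<one>\<^sub>m"

lemma one_closed: "\<one>\<^sub>m \<in> carrier M"
  by (simp add: mv_one_def zero_closed neg_closed)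

lemma times_closed: "\<lbrakk>x \<in> carrier M; y \<in> carrier M\<rbrakk> \<Longrightarrow> x \<odot>\<^sub>m y \<in> carrier M"
  by (simp add: mv_times_def plus_closed neg_closed)

lemmas closed [simp] = zero_closed neg_closed plus_closed one_closed times_closed

lemma join_closed [simp]: "\<lbrakk>x \<in> carrier M; y \<in> carrier M\<rbrakk> \<Longrightarrow> mv_join M x y \<in> carrier M"
  by (simp add: mv_join_def)

lemma meet_closed [simp]: "\<lbrakk>x \<in> carrier M; y \<in> carrier M\<rbrakk> \<Longrightarrow> mv_meet M x y \<in> carrier M"
  by (simp add: mv_meet_def)

lemma plus_lcomm:
  "\<lbrakk>x \<in> carrier M; y \<in> carrier M; z \<in> carrier M\<rbrakk> \<Longrightarrow> x \<oplus>\<^sub>m (y \<oplus>\<^sub>m z) = y \<oplus>\<^sub>m (x \<oplus>\<^sub>m z)"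
  by (simp add: plus_assoc[symmetric] plus_comm[of x y])

lemmas plus_ac = plus_assoc plus_comm plus_lcomm

lemma neg_zero [simp]: "\<sim> \<zero>\<^sub>m = \<one>\<^sub>m"
  by (simp add: mv_one_def)

lemma neg_one [simp]: "\<sim> \<one>\<^sub>m = \<zero>\<^sub>m"
  using neg_neg[OF zero_closed] by simp

declare neg_neg [simp] plus_zero [simp]

lemma zero_plus [simp]: "x \<in> carrier M \<Longrightarrow> \<zero>\<^sub>m \<oplus>\<^sub>m x = x"
  using plus_comm[of x "\<zero>\<^sub>m"] by simp

lemma plus_one' [simp]: "x \<in> carrier M \<Longrightarrow> x \<oplus>\<^sub>m \<one>\<^sub>m = \<one>\<^sub>m"
  using plus_one by simp

lemma one_plus [simp]: "x \<in> carrier M \<Longrightarrow> \<one>\<^sub>m \<oplus>\<^sub>m x = \<one>\<^sub>m"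
  using plus_comm[of x "\<one>\<^sub>m"] by simp

text \<open>With \<open>y\<close> taken to be 1 in the Lukasiewicz axiom, one side collapses to 1
  and the other to \<open>\<sim> x \<oplus> x\<close>.\<close>

lemma neg_plus_self [simp]: "x \<in> carrier M \<Longrightarrow> \<sim> x \<oplus>\<^sub>m x = \<one>\<^sub>m"
  using lukasiewicz[of x "\<one>\<^sub>m"] by simp

lemma plus_neg_self [simp]: "x \<in> carrier M \<Longrightarrow> x \<oplus>\<^sub>m \<sim> x = \<one>\<^sub>m"
  using plus_comm[of x "\<sim> x"] by simp

lemma neg_plus: "\<lbrakk>x \<in> carrier M; y \<in> carrier M\<rbrakk> \<Longrightarrow> \<sim> (x \<oplus>\<^sub>m y) = \<sim> x \<odot>\<^sub>m \<sim> y"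
  by (simp add: mv_times_def)

lemma neg_times: "\<lbrakk>x \<in> carrier M; y \<in> carrier M\<rbrakk> \<Longrightarrow> \<sim> (x \<odot>\<^sub>m y) = \<sim> x \<oplus>\<^sub>m \<sim> y"
  by (simp add: mv_times_def)

lemma times_comm: "\<lbrakk>x \<in> carrier M; y \<in> carrier M\<rbrakk> \<Longrightarrow> x \<odot>\<^sub>m y = y \<odot>\<^sub>m x"
  by (simp add: mv_times_def plus_comm)

lemma times_assoc:
  "\<lbrakk>x \<in> carrier M; y \<in> carrier M; z \<in> carrier M\<rbrakk> \<Longrightarrow> (x \<odot>\<^sub>m y) \<odot>\<^sub>m z = x \<odot>\<^sub>m (y \<odot>\<^sub>m z)"
  by (simp add: mv_times_def plus_assoc)

lemma times_neg_self [simp]: "x \<in> carrier M \<Longrightarrow> x \<odot>\<^sub>m \<sim> x = \<zero>\<^sub>m"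
  by (simp add: mv_times_def)

lemma times_one [simp]: "x \<in> carrier M \<Longrightarrow> x \<odot>\<^sub>m \<one>\<^sub>m = x"
  by (simp add: mv_times_def)

section \<open>Natural order, lattice operations and residuation\<close>

lemma le_refl [simp]: "x \<in> carrier M \<Longrightarrow> x \<sqsubseteq> x"
  by (simp add: le_def)

lemma zero_le [simp]: "x \<in> carrier M \<Longrightarrow> \<zero>\<^sub>m \<sqsubseteq> x"
  by (simp add: le_def)

lemma le_one [simp]: "x \<in> carrier M \<Longrightarrow> x \<sqsubseteq> \<one>\<^sub>m"
  by (simp add: le_def)

text \<open>Under the two inequalities the sides of the Lukasiewicz axiom reduce to \<open>y\<close>
  and \<open>x\<close>.\<close>

lemma le_antisym:
  assumes "x \<in> carrier M" "y \<in> carrier M" "x \<sqsubseteq> y" "y \<sqsubseteq> x"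
  shows "x = y"
  using lukasiewicz[of x y] assms by (simp add: le_def)

lemma join_eq:
  assumes "x \<in> carrier M" "y \<in> carrier M"
  shows "mv_join M x y = \<sim> (\<sim> x \<oplus>\<^sub>m y) \<oplus>\<^sub>m y"
  using assms by (simp add: mv_join_def mv_times_def)

lemma join_comm: "\<lbrakk>x \<in> carrier M; y \<in> carrier M\<rbrakk> \<Longrightarrow> mv_join M x y = mv_join M y x"
  using lukasiewicz[of x y] by (simp add: join_eq)

lemma join_absorb2: "\<lbrakk>x \<in> carrier M; y \<in> carrier M; x \<sqsubseteq> y\<rbrakk> \<Longrightarrow> mv_join M x y = y"
  by (simp add: join_eq le_def)

lemma le_plus [simp]: "\<lbrakk>x \<in> carrier M; y \<in> carrier M\<rbrakk> \<Longrightarrow> x \<sqsubseteq> x \<oplus>\<^sub>m y"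
  by (simp add: le_def plus_assoc[symmetric])

lemma le_plus2 [simp]: "\<lbrakk>x \<in> carrier M; y \<in> carrier M\<rbrakk> \<Longrightarrow> x \<sqsubseteq> y \<oplus>\<^sub>m x"
  using le_plus[of x y] by (simp add: plus_comm)

text \<open>The witness is the truncated difference \<open>y \<odot> \<sim> x\<close>, because the
  join of \<open>y\<close> and \<open>x\<close> is this difference plus \<open>x\<close>.
  Transitivity and monotonicity of the sum thereby become rearrangements of sums.\<close>

lemma le_iff_plus:
  assumes "x \<in> carrier M" "y \<in> carrier M"
  shows "x \<sqsubseteq> y \<longleftrightarrow> (\<exists>z \<in> carrier M. y = x \<oplus>\<^sub>m z)"
proof
  assume "x \<sqsubseteq> y"
  then have "y = mv_join M y x" using assms join_absorb2 join_comm by simp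
  then have "y = x \<oplus>\<^sub>m (y \<odot>\<^sub>m \<sim> x)" using assms by (simp add: mv_join_def plus_comm)
  then show "\<exists>z \<in> carrier M. y = x \<oplus>\<^sub>m z" using assms by (meson closed)
qed (use assms in auto)

lemma le_trans:
  assumes "x \<in> carrier M" "y \<in> carrier M" "z \<in> carrier M" "x \<sqsubseteq> y" "y \<sqsubseteq> z"
  shows "x \<sqsubseteq> z"
proof -
  obtain u v where "u \<in> carrier M" "v \<in> carrier M" "y = x \<oplus>\<^sub>m u" "z = y \<oplus>\<^sub>m v"
    using assms le_iff_plus by meson
  then show ?thesis using assms by (simp add: plus_assoc)
qed

lemma plus_mono:
  assumes "x \<in> carrier M" "y \<in> carrier M" "x' \<in> carrier M" "y' \<in> carrier M" "x \<sqsubseteq> x'" "y \<sqsubseteq> y'"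
  shows "x \<oplus>\<^sub>m y \<sqsubseteq> x' \<oplus>\<^sub>m y'"
proof -
  obtain z w where "z \<in> carrier M" "w \<in> carrier M" "x' = x \<oplus>\<^sub>m z" "y' = y \<oplus>\<^sub>m w"
    using assms le_iff_plus by meson
  then have "x' \<oplus>\<^sub>m y' = (x \<oplus>\<^sub>m y) \<oplus>\<^sub>m (z \<oplus>\<^sub>m w)" using assms by (simp add: plus_ac)
  then show ?thesis using assms \<open>z \<in> carrier M\<close> \<open>w \<in> carrier M\<close> by simp
qed

lemma neg_le_neg [simp]: "\<lbrakk>x \<in> carrier M; y \<in> carrier M\<rbrakk> \<Longrightarrow> \<sim> x \<sqsubseteq> \<sim> y \<longleftrightarrow> y \<sqsubseteq> x"
  by (simp add: le_def plus_comm)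

text \<open>Both sides unfold to the equation that \<open>\<sim> x \<oplus> y \<oplus> z\<close> is
  1. Thus \<open>x \<odot> \<sim> y\<close> acts as truncated subtraction.\<close>

lemma residuation:
  "\<lbrakk>x \<in> carrier M; y \<in> carrier M; z \<in> carrier M\<rbrakk> \<Longrightarrow> x \<odot>\<^sub>m \<sim> y \<sqsubseteq> z \<longleftrightarrow> x \<sqsubseteq> y \<oplus>\<^sub>m z"
  by (simp add: le_def mv_times_def plus_assoc)

lemma times_mono:
  assumes "x \<in> carrier M" "y \<in> carrier M" "x' \<in> carrier M" "y' \<in> carrier M" "x \<sqsubseteq> x'" "y \<sqsubseteq> y'"
  shows "x \<odot>\<^sub>m y \<sqsubseteq> x' \<odot>\<^sub>m y'"
  using assms by (simp add: mv_times_def plus_mono)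

lemma times_le1 [simp]: "\<lbrakk>x \<in> carrier M; y \<in> carrier M\<rbrakk> \<Longrightarrow> x \<odot>\<^sub>m y \<sqsubseteq> x"
  using times_mono[of x y x "\<one>\<^sub>m"] by simp

lemma times_le2 [simp]: "\<lbrakk>x \<in> carrier M; y \<in> carrier M\<rbrakk> \<Longrightarrow> x \<odot>\<^sub>m y \<sqsubseteq> y"
  using times_le1[of y x] by (simp add: times_comm)

lemma le_zero: "\<lbrakk>x \<in> carrier M; x \<sqsubseteq> \<zero>\<^sub>m\<rbrakk> \<Longrightarrow> x = \<zero>\<^sub>m"
  by (simp add: le_antisym)

lemma join_ge2 [simp]: "\<lbrakk>x \<in> carrier M; y \<in> carrier M\<rbrakk> \<Longrightarrow> y \<sqsubseteq> mv_join M x y"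
  by (simp add: mv_join_def)

lemma join_ge1 [simp]: "\<lbrakk>x \<in> carrier M; y \<in> carrier M\<rbrakk> \<Longrightarrow> x \<sqsubseteq> mv_join M x y"
  using join_ge2[of y x] join_comm[of x y] by simp

text \<open>An element \<open>z\<close> above \<open>y\<close> equals its difference from
  \<open>y\<close> plus \<open>y\<close>; the join has the same shape with \<open>x\<close> in place
  of \<open>z\<close>, so monotonicity compares the two.\<close>

lemma join_least:
  assumes "x \<in> carrier M" "y \<in> carrier M" "z \<in> carrier M" "x \<sqsubseteq> z" "y \<sqsubseteq> z"
  shows "mv_join M x y \<sqsubseteq> z"
proof -
  have "z = (z \<odot>\<^sub>m \<sim> y) \<oplus>\<^sub>m y"
    using assms join_absorb2[of y z] join_comm[of y z] by (simp add: mv_join_def)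
  moreover have "(x \<odot>\<^sub>m \<sim> y) \<oplus>\<^sub>m y \<sqsubseteq> (z \<odot>\<^sub>m \<sim> y) \<oplus>\<^sub>m y"
    using assms by (intro plus_mono times_mono) auto
  ultimately show ?thesis by (simp add: mv_join_def)
qed

lemma meet_le1 [simp]: "\<lbrakk>x \<in> carrier M; y \<in> carrier M\<rbrakk> \<Longrightarrow> mv_meet M x y \<sqsubseteq> x"
  using neg_le_neg[of "mv_join M (\<sim> x) (\<sim> y)" "\<sim> x"] by (simp add: mv_meet_def)

lemma meet_le2 [simp]: "\<lbrakk>x \<in> carrier M; y \<in> carrier M\<rbrakk> \<Longrightarrow> mv_meet M x y \<sqsubseteq> y"
  using neg_le_neg[of "mv_join M (\<sim> x) (\<sim> y)" "\<sim> y"] by (simp add: mv_meet_def)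

lemma meet_greatest:
  assumes "x \<in> carrier M" "y \<in> carrier M" "z \<in> carrier M" "z \<sqsubseteq> x" "z \<sqsubseteq> y"
  shows "z \<sqsubseteq> mv_meet M x y"
  using assms join_least[of "\<sim> x" "\<sim> y" "\<sim> z"] neg_le_neg[of "\<sim> z" "mv_join M (\<sim> x) (\<sim> y)"]
  by (simp add: mv_meet_def)

lemma meet_eq_iff_le:
  "\<lbrakk>x \<in> carrier M; y \<in> carrier M\<rbrakk> \<Longrightarrow> mv_meet M x y = x \<longleftrightarrow> x \<sqsubseteq> y"
  using meet_greatest[of x y x] by (auto intro: le_antisym) (metis meet_le2)

lemma meet_comm: "\<lbrakk>x \<in> carrier M; y \<in> carrier M\<rbrakk> \<Longrightarrow> mv_meet M x y = mv_meet M y x"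
  by (simp add: mv_meet_def join_comm)

lemma meet_eq:
  assumes "x \<in> carrier M" "y \<in> carrier M"
  shows "mv_meet M x y = x \<odot>\<^sub>m (\<sim> x \<oplus>\<^sub>m y)"
proof -
  have "mv_meet M x y = mv_meet M y x" using assms by (rule meet_comm)
  also have "\<dots> = x \<odot>\<^sub>m (\<sim> x \<oplus>\<^sub>m y)"
    using assms by (simp add: mv_meet_def mv_join_def mv_times_def plus_comm)
  finally show ?thesis .
qed

lemma join_of_le:
  assumes "x \<in> carrier M" "y \<in> carrier M" "x \<sqsubseteq> y"
  shows "mv_join M x y = y" "mv_join M y x = y" "mv_meet M x y = x" "mv_meet M y x = x"
  using assms join_absorb2[of x y] join_comm[of x y] meet_eq_iff_le[of x y] meet_comm[of x y] by auto

lemma plus_eq_one_iff: "\<lbrakk>x \<in> carrier M; y \<in> carrier M\<rbrakk> \<Longrightarrow> x \<oplus>\<^sub>m y = \<one>\<^sub>m \<longleftrightarrow> \<sim> x \<sqsubseteq> y"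
  by (simp add: le_def)

lemma times_eq_zero_iff: "\<lbrakk>x \<in> carrier M; y \<in> carrier M\<rbrakk> \<Longrightarrow> x \<odot>\<^sub>m y = \<zero>\<^sub>m \<longleftrightarrow> x \<sqsubseteq> \<sim> y"
  using residuation[of x "\<sim> y" "\<zero>\<^sub>m"] le_zero[of "x \<odot>\<^sub>m y"] by auto

section \<open>Orthogonal elements\<close>

definition orth (infix \<open>\<bottom>\<close> 50) where
  "u \<bottom> v \<longleftrightarrow> (\<forall>w \<in> carrier M. w \<sqsubseteq> u \<longrightarrow> w \<sqsubseteq> v \<longrightarrow> w = \<zero>\<^sub>m)"

lemma orth_sym: "u \<bottom> v \<Longrightarrow> v \<bottom> u"
  by (auto simp: orth_def)

text \<open>Subtracting \<open>u\<close> from a common lower bound \<open>w\<close> leaves an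
  element below both \<open>u'\<close> and \<open>v\<close>, hence 0, so \<open>w\<close> is already
  below \<open>u\<close>. Phrasing orthogonality through common lower bounds avoids distributing a
  meet over a sum.\<close>

lemma orth_plus:
  assumes "u \<in> carrier M" "u' \<in> carrier M" "v \<in> carrier M" "u \<bottom> v" "u' \<bottom> v"
  shows "u \<oplus>\<^sub>m u' \<bottom> v"
  unfolding orth_def
proof (intro ballI impI)
  fix w assume w: "w \<in> carrier M" "w \<sqsubseteq> u \<oplus>\<^sub>m u'" "w \<sqsubseteq> v"
  have "w \<odot>\<^sub>m \<sim> u \<sqsubseteq> u'" using w assms by (simp add: residuation)
  moreover have "w \<odot>\<^sub>m \<sim> u \<sqsubseteq> v" using w assms le_trans[of "w \<odot>\<^sub>m \<sim> u" w v] by simp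
  ultimately have "w \<odot>\<^sub>m \<sim> u = \<zero>\<^sub>m" using w assms by (auto simp: orth_def)
  then have "w \<sqsubseteq> u" using w assms by (simp add: times_eq_zero_iff)
  then show "w = \<zero>\<^sub>m" using w assms by (auto simp: orth_def)
qed

text \<open>Computed directly from the axioms: commutativity of a meet rewrites the meet of the two
  differences into a product, which is then bounded by \<open>y \<odot> \<sim> y\<close>.\<close>

lemma orth_diff:
  assumes x: "x \<in> carrier M" and y: "y \<in> carrier M"
  shows "x \<odot>\<^sub>m \<sim> y \<bottom> y \<odot>\<^sub>m \<sim> x"
proof -
  let ?q = "y \<odot>\<^sub>m \<sim> x"
  let ?r = "\<sim> (y \<oplus>\<^sub>m ?q)"
  have "mv_meet M (x \<odot>\<^sub>m \<sim> y) ?q = (x \<odot>\<^sub>m \<sim> y) \<odot>\<^sub>m (\<sim> x \<oplus>\<^sub>m (y \<oplus>\<^sub>m ?q))"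
    using x y by (simp add: meet_eq neg_times plus_assoc)
  also have "\<dots> = \<sim> y \<odot>\<^sub>m (x \<odot>\<^sub>m (\<sim> x \<oplus>\<^sub>m (y \<oplus>\<^sub>m ?q)))"
    using x y by (simp add: times_comm[of x "\<sim> y"] times_assoc)
  \<comment> \<open>Both sides are the meet of \<open>x\<close> and \<open>y \<oplus> ?q\<close>,
    read from its two arguments. Afterwards \<open>\<sim> y \<odot> (y \<oplus> ?q)\<close> is
    recognised as the meet of \<open>\<sim> y\<close> and \<open>?q\<close>.\<close>
  also have "x \<odot>\<^sub>m (\<sim> x \<oplus>\<^sub>m (y \<oplus>\<^sub>m ?q)) = (y \<oplus>\<^sub>m ?q) \<odot>\<^sub>m (?r \<oplus>\<^sub>m x)"
    using x y meet_eq[of x "y \<oplus>\<^sub>m ?q"] meet_eq[of "y \<oplus>\<^sub>m ?q" x] meet_comm[of x "y \<oplus>\<^sub>m ?q"] by simp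
  also have "\<sim> y \<odot>\<^sub>m ((y \<oplus>\<^sub>m ?q) \<odot>\<^sub>m (?r \<oplus>\<^sub>m x)) = mv_meet M (\<sim> y) ?q \<odot>\<^sub>m (x \<oplus>\<^sub>m ?r)"
    using x y by (simp add: meet_eq times_assoc plus_comm)
  finally have eq: "mv_meet M (x \<odot>\<^sub>m \<sim> y) ?q = mv_meet M (\<sim> y) ?q \<odot>\<^sub>m (x \<oplus>\<^sub>m ?r)" .
  have "mv_meet M (\<sim> y) ?q \<odot>\<^sub>m (x \<oplus>\<^sub>m ?r) \<sqsubseteq> ?q \<odot>\<^sub>m (x \<oplus>\<^sub>m ?r)"
    using x y by (intro times_mono) auto
  \<comment> \<open>The factor \<open>\<sim> x\<close> of \<open>?q\<close> combines with
    \<open>x \<oplus> ?r\<close> into a meet, which lies below \<open>?r\<close> and hence below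
    \<open>\<sim> y\<close>.\<close>
  moreover have "?q \<odot>\<^sub>m (x \<oplus>\<^sub>m ?r) = y \<odot>\<^sub>m mv_meet M (\<sim> x) ?r"
    using x y by (simp add: meet_eq times_assoc)
  moreover have "y \<odot>\<^sub>m mv_meet M (\<sim> x) ?r \<sqsubseteq> y \<odot>\<^sub>m \<sim> y"
  proof -
    have "?r \<sqsubseteq> \<sim> y" using x y by simp
    then have "mv_meet M (\<sim> x) ?r \<sqsubseteq> \<sim> y"
      using x y le_trans[of "mv_meet M (\<sim> x) ?r" ?r "\<sim> y"] by simp
    then show ?thesis using x y by (intro times_mono) auto
  qed
  ultimately have "mv_meet M (x \<odot>\<^sub>m \<sim> y) ?q \<sqsubseteq> \<zero>\<^sub>m"
    using x y eq le_trans[of "mv_meet M (\<sim> y) ?q \<odot>\<^sub>m (x \<oplus>\<^sub>m ?r)" "?q \<odot>\<^sub>m (x \<oplus>\<^sub>m ?r)" "\<zero>\<^sub>m"] by simp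
  then have z: "mv_meet M (x \<odot>\<^sub>m \<sim> y) ?q = \<zero>\<^sub>m" using x y by (intro le_zero) simp_all
  show ?thesis
    unfolding orth_def
  proof (intro ballI impI)
    fix w assume "w \<in> carrier M" "w \<sqsubseteq> x \<odot>\<^sub>m \<sim> y" "w \<sqsubseteq> ?q"
    then show "w = \<zero>\<^sub>m"
      using meet_greatest[of "x \<odot>\<^sub>m \<sim> y" ?q w] x y z by (simp add: le_zero)
  qed
qed

section \<open>Multiples and the preorder modulo an ideal\<close>

primrec mult :: "nat \<Rightarrow> 'a \<Rightarrow> 'a" where
  "mult 0 u = \<zero>\<^sub>m"
| "mult (Suc n) u = mult n u \<oplus>\<^sub>m u"

lemma mult_closed [simp]: "u \<in> carrier M \<Longrightarrow> mult n u \<in> carrier M"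
  by (induction n) auto

lemma mult_add: "u \<in> carrier M \<Longrightarrow> mult (m + n) u = mult m u \<oplus>\<^sub>m mult n u"
  by (induction n) (auto simp: plus_assoc)

lemma orth_mult:
  assumes "u \<in> carrier M" "v \<in> carrier M" "u \<bottom> v"
  shows "mult m u \<bottom> mult n v"
proof -
  \<comment> \<open>Multiples are formed on one side only; symmetry of orthogonality then yields
    both sides.\<close>
  have *: "mult n u' \<bottom> v'" if "u' \<in> carrier M" "v' \<in> carrier M" "u' \<bottom> v'" for u' v' n
  proof (induction n)
    case 0
    show ?case by (auto simp: orth_def le_zero)
  next
    case (Suc n)
    then show ?case using that orth_plus[of "mult n u'" u' v'] by simp
  qed
  show ?thesis using assms *[of v u n] *[of u "mult n v" m] by (simp add: orth_sym)
qed

text \<open>The order of the quotient by the ideal generated by \<open>u\<close>; the ideal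
  congruence is its symmetric part. The one-sided form suits the positive operations, which are
  monotone in each argument.\<close>

definition le_mod where "le_mod u x y \<longleftrightarrow> (\<exists>n. x \<sqsubseteq> y \<oplus>\<^sub>m mult n u)"

lemma le_imp_le_mod: "\<lbrakk>x \<in> carrier M; y \<in> carrier M; x \<sqsubseteq> y\<rbrakk> \<Longrightarrow> le_mod u x y"
  unfolding le_mod_def by (rule exI[of _ 0]) simp

lemma le_plus_imp_le_mod: "\<lbrakk>u \<in> carrier M; x \<sqsubseteq> y \<oplus>\<^sub>m u\<rbrakk> \<Longrightarrow> le_mod u x y"
  unfolding le_mod_def by (rule exI[of _ "Suc 0"]) simp

lemma le_mod_trans:
  assumes u: "u \<in> carrier M" and xyz: "x \<in> carrier M" "y \<in> carrier M" "z \<in> carrier M"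
    and "le_mod u x y" "le_mod u y z"
  shows "le_mod u x z"
proof -
  obtain m n where "x \<sqsubseteq> y \<oplus>\<^sub>m mult m u" "y \<sqsubseteq> z \<oplus>\<^sub>m mult n u"
    using assms by (auto simp: le_mod_def)
  moreover from this have "y \<oplus>\<^sub>m mult m u \<sqsubseteq> z \<oplus>\<^sub>m mult n u \<oplus>\<^sub>m mult m u"
    using u xyz by (intro plus_mono) auto
  ultimately have "x \<sqsubseteq> z \<oplus>\<^sub>m mult n u \<oplus>\<^sub>m mult m u"
    using u xyz le_trans[of x "y \<oplus>\<^sub>m mult m u" "z \<oplus>\<^sub>m mult n u \<oplus>\<^sub>m mult m u"] by simp
  then have "x \<sqsubseteq> z \<oplus>\<^sub>m mult (n + m) u" using u xyz by (simp add: mult_add plus_assoc)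
  then show ?thesis by (auto simp: le_mod_def)
qed

lemma le_mod_common:
  assumes u: "u \<in> carrier M" and c: "x \<in> carrier M" "y \<in> carrier M" "x' \<in> carrier M" "y' \<in> carrier M"
    and "le_mod u x x'" "le_mod u y y'"
  obtains n where "x \<sqsubseteq> x' \<oplus>\<^sub>m mult n u" "y \<sqsubseteq> y' \<oplus>\<^sub>m mult n u"
proof -
  obtain m n where mn: "x \<sqsubseteq> x' \<oplus>\<^sub>m mult m u" "y \<sqsubseteq> y' \<oplus>\<^sub>m mult n u"
    using assms by (auto simp: le_mod_def)
  have "x' \<oplus>\<^sub>m mult m u \<sqsubseteq> x' \<oplus>\<^sub>m mult (m + n) u" "y' \<oplus>\<^sub>m mult n u \<sqsubseteq> y' \<oplus>\<^sub>m mult (m + n) u"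
    using u c by (auto intro!: plus_mono simp: mult_add)
  then have "x \<sqsubseteq> x' \<oplus>\<^sub>m mult (m + n) u" "y \<sqsubseteq> y' \<oplus>\<^sub>m mult (m + n) u"
    using u c mn le_trans[of x "x' \<oplus>\<^sub>m mult m u"] le_trans[of y "y' \<oplus>\<^sub>m mult n u"] by simp_all
  then show thesis using that by blast
qed

text \<open>Residuation gives \<open>p \<sqsubseteq> \<sim> q \<oplus> (p \<odot> q)\<close>; adding
  \<open>i\<close> and residuating back moves an error term out of one factor. Treating the factors
  in turn moves out both.\<close>

lemma times_plus_le:
  assumes "x \<in> carrier M" "y \<in> carrier M" "k \<in> carrier M" "l \<in> carrier M"
  shows "(x \<oplus>\<^sub>m k) \<odot>\<^sub>m (y \<oplus>\<^sub>m l) \<sqsubseteq> (x \<odot>\<^sub>m y) \<oplus>\<^sub>m (k \<oplus>\<^sub>m l)"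
proof -
  have half: "(p \<oplus>\<^sub>m i) \<odot>\<^sub>m q \<sqsubseteq> (p \<odot>\<^sub>m q) \<oplus>\<^sub>m i"
    if [simp]: "p \<in> carrier M" "q \<in> carrier M" "i \<in> carrier M" for p q i
  proof -
    have "p \<sqsubseteq> \<sim> q \<oplus>\<^sub>m (p \<odot>\<^sub>m q)" using residuation[of p "\<sim> q" "p \<odot>\<^sub>m q"] by simp
    then have "p \<oplus>\<^sub>m i \<sqsubseteq> \<sim> q \<oplus>\<^sub>m (p \<odot>\<^sub>m q) \<oplus>\<^sub>m i" by (intro plus_mono) auto
    then show ?thesis using residuation[of "p \<oplus>\<^sub>m i" "\<sim> q" "(p \<odot>\<^sub>m q) \<oplus>\<^sub>m i"] by (simp add: plus_assoc)
  qed
  have "(x \<oplus>\<^sub>m k) \<odot>\<^sub>m (y \<oplus>\<^sub>m l) \<sqsubseteq> (x \<odot>\<^sub>m (y \<oplus>\<^sub>m l)) \<oplus>\<^sub>m k" using assms by (intro half) auto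
  moreover have "x \<odot>\<^sub>m (y \<oplus>\<^sub>m l) \<sqsubseteq> (x \<odot>\<^sub>m y) \<oplus>\<^sub>m l"
    using assms half[of y x l] by (simp add: times_comm)
  then have "(x \<odot>\<^sub>m (y \<oplus>\<^sub>m l)) \<oplus>\<^sub>m k \<sqsubseteq> (x \<odot>\<^sub>m y) \<oplus>\<^sub>m l \<oplus>\<^sub>m k"
    using assms by (intro plus_mono) auto
  ultimately have "(x \<oplus>\<^sub>m k) \<odot>\<^sub>m (y \<oplus>\<^sub>m l) \<sqsubseteq> (x \<odot>\<^sub>m y) \<oplus>\<^sub>m l \<oplus>\<^sub>m k"
    using assms le_trans[of "(x \<oplus>\<^sub>m k) \<odot>\<^sub>m (y \<oplus>\<^sub>m l)" "(x \<odot>\<^sub>m (y \<oplus>\<^sub>m l)) \<oplus>\<^sub>m k"] by simp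
  then show ?thesis using assms by (simp add: plus_ac)
qed

lemma le_mod_ops:
  assumes u: "u \<in> carrier M" and c: "x \<in> carrier M" "y \<in> carrier M" "x' \<in> carrier M" "y' \<in> carrier M"
    and "le_mod u x x'" "le_mod u y y'"
  shows "le_mod u (mv_join M x y) (mv_join M x' y')"
    and "le_mod u (mv_meet M x y) (mv_meet M x' y')"
    and "le_mod u (x \<oplus>\<^sub>m y) (x' \<oplus>\<^sub>m y')"
    and "le_mod u (x \<odot>\<^sub>m y) (x' \<odot>\<^sub>m y')"
proof -
  obtain n where n: "x \<sqsubseteq> x' \<oplus>\<^sub>m mult n u" "y \<sqsubseteq> y' \<oplus>\<^sub>m mult n u"
    using le_mod_common[OF assms] by blast
  let ?k = "mult n u"
  have kk: "mult (n + n) u = ?k \<oplus>\<^sub>m ?k" using u by (rule mult_add)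
  have k: "?k \<in> carrier M" using u by simp
  have "x' \<oplus>\<^sub>m ?k \<sqsubseteq> mv_join M x' y' \<oplus>\<^sub>m ?k" "y' \<oplus>\<^sub>m ?k \<sqsubseteq> mv_join M x' y' \<oplus>\<^sub>m ?k"
    using c k by (auto intro!: plus_mono)
  then have "x \<sqsubseteq> mv_join M x' y' \<oplus>\<^sub>m ?k" "y \<sqsubseteq> mv_join M x' y' \<oplus>\<^sub>m ?k"
    using c k n le_trans[of x "x' \<oplus>\<^sub>m ?k"] le_trans[of y "y' \<oplus>\<^sub>m ?k"] by simp_all
  then show "le_mod u (mv_join M x y) (mv_join M x' y')"
    unfolding le_mod_def using c k by (intro exI[of _ n] join_least) auto
  have "mv_meet M x y \<sqsubseteq> ?k \<oplus>\<^sub>m x'" "mv_meet M x y \<sqsubseteq> ?k \<oplus>\<^sub>m y'"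
    using c k n le_trans[of "mv_meet M x y" x "x' \<oplus>\<^sub>m ?k"] le_trans[of "mv_meet M x y" y "y' \<oplus>\<^sub>m ?k"]
    by (simp_all add: plus_comm)
  \<comment> \<open>Shifting the error \<open>?k\<close> to the left by residuation reduces the
    claim to one bound for each argument of the meet.\<close>
  then have "mv_meet M x y \<odot>\<^sub>m \<sim> ?k \<sqsubseteq> mv_meet M x' y'"
    using c k by (intro meet_greatest) (auto simp: residuation)
  then show "le_mod u (mv_meet M x y) (mv_meet M x' y')"
    unfolding le_mod_def using c k by (auto simp: residuation plus_comm)
  \<comment> \<open>Each argument contributes one \<open>?k\<close>, so sum and product need the
    error \<open>mult (n + n) u\<close>.\<close>
  have "x \<oplus>\<^sub>m y \<sqsubseteq> (x' \<oplus>\<^sub>m ?k) \<oplus>\<^sub>m (y' \<oplus>\<^sub>m ?k)" using c k n by (intro plus_mono) auto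
  also have "(x' \<oplus>\<^sub>m ?k) \<oplus>\<^sub>m (y' \<oplus>\<^sub>m ?k) = (x' \<oplus>\<^sub>m y') \<oplus>\<^sub>m mult (n + n) u"
    using c k kk by (simp add: plus_ac)
  finally show "le_mod u (x \<oplus>\<^sub>m y) (x' \<oplus>\<^sub>m y')" unfolding le_mod_def by blast
  have "x \<odot>\<^sub>m y \<sqsubseteq> (x' \<oplus>\<^sub>m ?k) \<odot>\<^sub>m (y' \<oplus>\<^sub>m ?k)" using c k n by (intro times_mono) auto
  then have "x \<odot>\<^sub>m y \<sqsubseteq> (x' \<odot>\<^sub>m y') \<oplus>\<^sub>m (?k \<oplus>\<^sub>m ?k)"
    by (rule le_trans[rotated 3]) (use c k times_plus_le[of x' y' ?k ?k] in auto)
  then show "le_mod u (x \<odot>\<^sub>m y) (x' \<odot>\<^sub>m y')" unfolding le_mod_def using kk by metis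
qed

text \<open>The difference \<open>x \<odot> \<sim> y\<close> lies below a multiple of
  \<open>u\<close> and below a multiple of \<open>v\<close>; these are orthogonal, so it
  vanishes.\<close>

lemma le_mod_orth:
  assumes "u \<in> carrier M" "v \<in> carrier M" "u \<bottom> v" "x \<in> carrier M" "y \<in> carrier M"
    and "le_mod u x y" "le_mod v x y"
  shows "x \<sqsubseteq> y"
proof -
  obtain m n where "x \<sqsubseteq> y \<oplus>\<^sub>m mult m u" "x \<sqsubseteq> y \<oplus>\<^sub>m mult n v"
    using assms by (auto simp: le_mod_def)
  then have "x \<odot>\<^sub>m \<sim> y \<sqsubseteq> mult m u" "x \<odot>\<^sub>m \<sim> y \<sqsubseteq> mult n v"
    using assms by (simp_all add: residuation)
  then have "x \<odot>\<^sub>m \<sim> y = \<zero>\<^sub>m" using assms orth_mult[of u v m n] by (auto simp: orth_def)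
  then show ?thesis using assms by (simp add: times_eq_zero_iff)
qed

section \<open>Stationary multiples and bounds of finite chains\<close>

lemma mult_mono: "u \<in> carrier M \<Longrightarrow> m \<le> n \<Longrightarrow> mult m u \<sqsubseteq> mult n u"
  using mult_add[of u m "n - m"] by simp

lemma plus_mult_absorb:
  assumes "x \<in> carrier M" "u \<in> carrier M" "x \<oplus>\<^sub>m u = x"
  shows "x \<oplus>\<^sub>m mult n u = x"
proof (induction n)
  case (Suc n)
  then show ?case using assms by (simp add: plus_assoc[symmetric])
qed (use assms in simp)

text \<open>The multiples of \<open>a\<close> become stationary at an idempotent \<open>e\<close>, and for an idempotent the
  dichotomy reads \<open>e = 1\<close> or \<open>e \<sqsubseteq> \<sim> e\<close>, the latter meaning \<open>e = 0\<close>.\<close>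

lemma mult_reaches_one:
  assumes fin: "finite T" and T: "T \<subseteq> carrier M" "\<zero>\<^sub>m \<in> T"
    and plus: "\<And>x y. \<lbrakk>x \<in> T; y \<in> T\<rbrakk> \<Longrightarrow> x \<oplus>\<^sub>m y \<in> T"
    and dich: "\<And>x y. \<lbrakk>x \<in> T; y \<in> T\<rbrakk> \<Longrightarrow> x \<oplus>\<^sub>m y = \<one>\<^sub>m \<or> x \<odot>\<^sub>m y = \<zero>\<^sub>m"
    and a: "a \<in> T" "a \<noteq> \<zero>\<^sub>m"
  shows "\<exists>n. mult n a = \<one>\<^sub>m"
proof -
  have aM: "a \<in> carrier M" using a T by auto
  have multT: "mult n a \<in> T" for n by (induction n) (use T plus a in auto)
  then have "finite (range (\<lambda>n. mult n a))"
    using fin by (meson finite_subset image_subsetI)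
  then have "\<not> inj (\<lambda>n. mult n a)" using finite_imageD infinite_UNIV_nat by blast
  then obtain i j where ij: "i < j" "mult i a = mult j a"
    by (metis linorder_neqE_nat injI)
  let ?e = "mult i a"
  \<comment> \<open>Multiples increase with the index, so the next one is squeezed between the two
    that coincide.\<close>
  have "mult (Suc i) a \<sqsubseteq> ?e" using ij aM mult_mono[of a "Suc i" j] by simp
  then have ea: "?e \<oplus>\<^sub>m a = ?e" using aM by (intro le_antisym) simp_all
  then have ee: "?e \<oplus>\<^sub>m ?e = ?e" using aM by (intro plus_mult_absorb) auto
  consider "?e \<oplus>\<^sub>m ?e = \<one>\<^sub>m" | "?e \<odot>\<^sub>m ?e = \<zero>\<^sub>m" using dich multT by blast
  then show ?thesis
  proof cases
    case 1
    then show ?thesis using ee by auto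
  next
    case 2
    then have "mv_meet M ?e (\<sim> ?e) = ?e"
      using aM by (simp add: times_eq_zero_iff meet_eq_iff_le)
    \<comment> \<open>The meet is \<open>\<sim> ?e \<odot> (?e \<oplus> ?e)\<close>, which
      idempotence turns into \<open>\<sim> ?e \<odot> ?e\<close>.\<close>
    moreover have "mv_meet M (\<sim> ?e) ?e = \<zero>\<^sub>m"
      using aM ee by (simp add: meet_eq times_comm[of "\<sim> ?e" ?e])
    ultimately have "?e = \<zero>\<^sub>m" using aM meet_comm[of ?e "\<sim> ?e"] by simp
    then show ?thesis using ea a aM by simp
  qed
qed

lemma finite_chain_bounds:
  assumes "finite F" "F \<noteq> {}" "F \<subseteq> carrier M"
    and "\<And>x y. \<lbrakk>x \<in> F; y \<in> F\<rbrakk> \<Longrightarrow> x \<sqsubseteq> y \<or> y \<sqsubseteq> x"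
  shows "(\<exists>m\<in>F. \<forall>x\<in>F. m \<sqsubseteq> x) \<and> (\<exists>m\<in>F. \<forall>x\<in>F. x \<sqsubseteq> m)"
  using assms
proof (induction F rule: finite_ne_induct)
  case (singleton x)
  then show ?case by simp
next
  case (insert z F)
  then obtain m p where m: "m \<in> F" "\<forall>x\<in>F. m \<sqsubseteq> x" and p: "p \<in> F" "\<forall>x\<in>F. x \<sqsubseteq> p"
    by auto
  have c: "z \<in> carrier M" "m \<in> carrier M" "p \<in> carrier M" "F \<subseteq> carrier M"
    using insert.prems m p by auto
  have "\<exists>m\<in>insert z F. \<forall>x\<in>insert z F. m \<sqsubseteq> x"
  proof (cases "m \<sqsubseteq> z")
    case True
    then show ?thesis using m by auto
  next
    case False
    then have "z \<sqsubseteq> m" using insert.prems(2)[of z m] m by auto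
    then have "\<forall>x\<in>F. z \<sqsubseteq> x" using m c le_trans[of z m] by (meson subsetD)
    then show ?thesis using c by auto
  qed
  moreover have "\<exists>m\<in>insert z F. \<forall>x\<in>insert z F. x \<sqsubseteq> m"
  proof (cases "z \<sqsubseteq> p")
    case True
    then show ?thesis using p by auto
  next
    case False
    then have "p \<sqsubseteq> z" using insert.prems(2)[of z p] p by auto
    then have "\<forall>x\<in>F. x \<sqsubseteq> z" using p c le_trans[of _ p z] by (meson subsetD)
    then show ?thesis using c by auto
  qed
  ultimately show ?case ..
qed

end

subsection \<open>Positive subreducts\<close>

locale positive_subreduct = mv_algebra M for M :: "'a mv" (structure) +
  fixes S
  assumes subuniverse: "pmv_subuniverse S (positive_reduct M)"
begin

abbreviation "B \<equiv> (positive_reduct M)\<lparr>carrier := S\<rparr>"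

lemma S_closed:
  "\<zero>\<^sub>m \<in> S" "\<one>\<^sub>m \<in> S"
  "\<lbrakk>x \<in> S; y \<in> S\<rbrakk> \<Longrightarrow> mv_join M x y \<in> S"
  "\<lbrakk>x \<in> S; y \<in> S\<rbrakk> \<Longrightarrow> mv_meet M x y \<in> S"
  "\<lbrakk>x \<in> S; y \<in> S\<rbrakk> \<Longrightarrow> x \<oplus>\<^sub>m y \<in> S"
  "\<lbrakk>x \<in> S; y \<in> S\<rbrakk> \<Longrightarrow> x \<odot>\<^sub>m y \<in> S"
  using subuniverse by (auto simp: pmv_subuniverse_def positive_reduct_def)

lemma S_carrier: "x \<in> S \<Longrightarrow> x \<in> carrier M"
  using subuniverse by (auto simp: pmv_subuniverse_def positive_reduct_def)

lemma mult_S: "u \<in> S \<Longrightarrow> mult n u \<in> S"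
  by (induction n) (auto simp: S_closed)

lemma pmv_le_iff: "\<lbrakk>x \<in> S; y \<in> S\<rbrakk> \<Longrightarrow> pmv_le B x y \<longleftrightarrow> x \<sqsubseteq> y"
  by (simp add: pmv_le_def positive_reduct_def meet_eq_iff_le S_carrier)

text \<open>The congruence of \<open>M\<close> modulo the ideal generated by \<open>u\<close>,
  restricted to \<open>S\<close>. The generator may lie outside \<open>S\<close>, since forming
  differences such as \<open>x \<odot> \<sim> y\<close> uses negation.\<close>

definition theta where
  "theta u = {(x, y). x \<in> S \<and> y \<in> S \<and> le_mod u x y \<and> le_mod u y x}"

lemma theta_congruence:
  assumes "u \<in> carrier M"
  shows "pmv_congruence B (theta u)"
  unfolding pmv_congruence_def
proof (intro conjI)
  have "refl_on S (theta u)"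
    by (auto simp: refl_on_def theta_def S_carrier intro: le_imp_le_mod)
  moreover have "sym (theta u)" by (auto simp: sym_def theta_def)
  moreover have "trans (theta u)"
    unfolding trans_def theta_def using le_mod_trans[OF assms] S_carrier by blast
  ultimately have "equiv S (theta u)" by (auto simp: equiv_def theta_def)
  then show "equiv (carrier B) (theta u)" by simp
  show "\<forall>(x, x')\<in>theta u. \<forall>(y, y')\<in>theta u.
      (p_join B x y, p_join B x' y') \<in> theta u \<and> (p_meet B x y, p_meet B x' y') \<in> theta u \<and>
      (p_plus B x y, p_plus B x' y') \<in> theta u \<and> (p_times B x y, p_times B x' y') \<in> theta u"
    using assms by (auto simp: theta_def positive_reduct_def S_closed S_carrier intro!: le_mod_ops)
qed

text \<open>Instead of passing to a subdirect representation by chains, split the identity congruence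
  by two orthogonal elements.\<close>

lemma irreducible_orth:
  assumes irr: "pmv_subdirectly_irreducible B"
    and uv: "u \<in> carrier M" "v \<in> carrier M" "u \<bottom> v"
  shows "theta u = Id_on S \<or> theta v = Id_on S"
proof -
  have "(x, y) \<in> Id_on S" if "(x, y) \<in> theta u" "(x, y) \<in> theta v" for x y
    using that uv le_mod_orth[OF uv] by (auto simp: theta_def S_carrier Id_on_iff intro!: le_antisym)
  moreover have "(x, x) \<in> theta w" if "x \<in> S" for x w
    using that by (auto simp: theta_def S_carrier intro: le_imp_le_mod)
  moreover have "theta u \<subseteq> S \<times> S" by (auto simp: theta_def)
  ultimately have "(S \<times> S) \<inter> \<Inter>{theta u, theta v} = Id_on S" by auto
  then have "Id_on S \<in> {theta u, theta v}"
    using pmv_subdirectly_irreducibleD[OF irr, of "{theta u, theta v}"] uv theta_congruence by simp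
  then show ?thesis by auto
qed

text \<open>Modulo \<open>x \<odot> \<sim> y\<close> the element \<open>x\<close> is identified with
  its meet with \<open>y\<close>, which belongs to \<open>S\<close>. If this congruence is trivial,
  then \<open>x \<sqsubseteq> y\<close>; otherwise the opposite difference gives the other
  comparison.\<close>

lemma irreducible_le:
  assumes irr: "pmv_subdirectly_irreducible B" and x: "x \<in> S" and y: "y \<in> S"
  shows "x \<sqsubseteq> y \<or> y \<sqsubseteq> x"
proof -
  have *: "x \<sqsubseteq> y" if xy: "x \<in> S" "y \<in> S" and eq: "theta (x \<odot>\<^sub>m \<sim> y) = Id_on S" for x y
  proof -
    let ?u = "x \<odot>\<^sub>m \<sim> y"
    have "x \<odot>\<^sub>m \<sim> ?u \<sqsubseteq> y"
      using xy residuation[of x "?u" y] residuation[of x y "?u"]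
      by (simp add: S_carrier plus_comm)
    then have "x \<odot>\<^sub>m \<sim> ?u \<sqsubseteq> mv_meet M x y"
      using xy by (intro meet_greatest) (auto simp: S_carrier)
    then have "x \<sqsubseteq> mv_meet M x y \<oplus>\<^sub>m ?u"
      using xy by (simp add: residuation S_carrier plus_comm)
    then have "(mv_meet M x y, x) \<in> theta ?u"
      using xy by (auto simp: theta_def S_closed S_carrier intro: le_imp_le_mod le_plus_imp_le_mod)
    then show ?thesis using xy eq meet_eq_iff_le[of x y] by (auto simp: S_carrier)
  qed
  have "theta (x \<odot>\<^sub>m \<sim> y) = Id_on S \<or> theta (y \<odot>\<^sub>m \<sim> x) = Id_on S"
    using x y by (intro irreducible_orth irr orth_diff) (auto simp: S_carrier)
  then show ?thesis using * x y by blast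
qed

text \<open>The elements \<open>x \<odot> y\<close> and \<open>\<sim> (x \<oplus> y)\<close> are the
  two differences between \<open>x\<close> and \<open>\<sim> y\<close>, hence orthogonal. The
  congruence of the first identifies \<open>x \<odot> y\<close> with 0, that of the second
  identifies \<open>x \<oplus> y\<close> with 1, and one of them is trivial.\<close>

lemma irreducible_dichotomy:
  assumes irr: "pmv_subdirectly_irreducible B" and x: "x \<in> S" and y: "y \<in> S"
  shows "x \<oplus>\<^sub>m y = \<one>\<^sub>m \<or> x \<odot>\<^sub>m y = \<zero>\<^sub>m"
proof -
  let ?u = "x \<odot>\<^sub>m y" and ?v = "\<sim> (x \<oplus>\<^sub>m y)"
  have c: "x \<in> carrier M" "y \<in> carrier M" using x y by (auto simp: S_carrier)
  have "?u \<bottom> ?v" using c orth_diff[of x "\<sim> y"] by (simp add: neg_plus times_comm)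
  then have "theta ?u = Id_on S \<or> theta ?v = Id_on S"
    using c by (intro irreducible_orth irr) auto
  moreover have "(?u, \<zero>\<^sub>m) \<in> theta ?u"
    using x y c by (auto simp: theta_def S_closed intro: le_imp_le_mod le_plus_imp_le_mod)
  moreover have "(x \<oplus>\<^sub>m y, \<one>\<^sub>m) \<in> theta ?v"
    using x y c by (auto simp: theta_def S_closed intro: le_imp_le_mod le_plus_imp_le_mod)
  ultimately show ?thesis by auto
qed

section \<open>Recognition of Lukasiewicz chains\<close>

lemma multiples_iso_luk:
  assumes a: "a \<in> carrier M" and N0: "N \<noteq> 0"
    and neg: "\<And>k. k \<le> N \<Longrightarrow> \<sim> (mult k a) = mult (N - k) a"
    and inj: "inj_on (\<lambda>k. mult k a) {..N}" and S: "S = (\<lambda>k. mult k a) ` {..N}"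
  shows "pmv_isomorphic B (luk_plus N)"
proof -
  let ?g = "\<lambda>k. mult k a"
  define idx where "idx = inv_into {..N} ?g"
  have idx: "idx (?g k) = k" if "k \<le> N" for k
    unfolding idx_def using inv_into_f_f[OF inj, of k] that by simp
  have one: "?g N = \<one>\<^sub>m" using neg[of 0] by simp
  \<comment> \<open>Since \<open>mult N a\<close> is 1, all later multiples stay at 1; this matches
    the truncated sum of \<open>luk_plus N\<close>.\<close>
  have cap: "?g k = ?g (min k N)" for k
  proof (cases "k \<le> N")
    case False
    then have "?g k = ?g N \<oplus>\<^sub>m ?g (k - N)" using mult_add[OF a, of N "k - N"] by simp
    then show ?thesis using False a by (simp add: one min_def)
  qed simp
  have plus: "?g i \<oplus>\<^sub>m ?g j = ?g (min (i + j) N)" for i j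
    using mult_add[OF a, of i j] cap[of "i + j"] by simp
  \<comment> \<open>De Morgan and the complement rule \<open>neg\<close> reduce the product to a sum
    of complements. Natural subtraction yields 0 when \<open>i + j \<le> N\<close>, as the truncated
    product requires.\<close>
  have times: "?g i \<odot>\<^sub>m ?g j = ?g (i + j - N)" if "i \<le> N" "j \<le> N" for i j
  proof -
    have "?g i \<odot>\<^sub>m ?g j = \<sim> (?g (min ((N - i) + (N - j)) N))"
      using that by (simp add: mv_times_def neg plus)
    also have "\<dots> = ?g (i + j - N)"
      using that neg[of "min ((N - i) + (N - j)) N"] by (auto simp: min_def)
    finally show ?thesis .
  qed
  have join: "mv_join M (?g i) (?g j) = ?g (max i j)" and meet: "mv_meet M (?g i) (?g j) = ?g (min i j)"
    for i j
    using a join_of_le[of "?g i" "?g j"] join_of_le[of "?g j" "?g i"]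
      mult_mono[OF a, of i j] mult_mono[OF a, of j i]
    by (cases "i \<le> j"; simp add: max_def min_def)+
  \<comment> \<open>The isomorphism sends \<open>mult k a\<close> to \<open>k / N\<close>.\<close>
  define h where "h = (\<lambda>x. real (idx x) / real N)"
  have hg: "h (?g k) = real k / real N" if "k \<le> N" for k
    using idx[OF that] by (simp add: h_def)
  have "bij_betw idx (?g ` {..N}) {..N}"
    unfolding idx_def using inj by (intro bij_betw_inv_into) (auto simp: bij_betw_def)
  moreover have "bij_betw (\<lambda>k. real k / real N) {..N} (carrier (luk_plus N))"
    using N0 by (auto simp: bij_betw_def inj_on_def luk_plus_def)
  ultimately have bij: "bij_betw h S (carrier (luk_plus N))"
    using bij_betw_trans[of idx _ _ "\<lambda>k. real k / real N"] by (simp add: o_def h_def S)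
  have "h \<in> pmv_iso B (luk_plus N)"
    unfolding pmv_iso_def
  proof (intro CollectI conjI ballI)
    show "bij_betw h (carrier B) (carrier (luk_plus N))" using bij by simp
    show "h (p_zero B) = p_zero (luk_plus N)" "h (p_one B) = p_one (luk_plus N)"
      using hg[of 0] hg[of N] one N0 by (simp_all add: positive_reduct_def luk_plus_def)
    fix x y assume "x \<in> carrier B" "y \<in> carrier B"
    then obtain i j where ij: "i \<le> N" "j \<le> N" and x: "x = ?g i" and y: "y = ?g j"
      using S by auto
    have "real (max i j) / real N = max (real i / real N) (real j / real N)"
      "real (min i j) / real N = min (real i / real N) (real j / real N)"
      by (simp_all add: max_divide_distrib_right min_divide_distrib_right of_nat_max of_nat_min)
    then show "h (p_join B x y) = p_join (luk_plus N) (h x) (h y)"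
      "h (p_meet B x y) = p_meet (luk_plus N) (h x) (h y)"
      using ij by (simp_all add: x y positive_reduct_def luk_plus_def join meet hg)
    have "real (min (i + j) N) / real N = min (real i / real N + real j / real N) 1"
      using N0 by (simp add: min_def field_simps flip: of_nat_add)
    then show "h (p_plus B x y) = p_plus (luk_plus N) (h x) (h y)"
      using ij by (simp add: x y positive_reduct_def luk_plus_def plus hg)
    have "real (i + j - N) / real N = max (real i / real N + real j / real N - 1) 0"
      using N0 by (cases "N \<le> i + j") (simp_all add: max_def field_simps of_nat_diff flip: of_nat_add)
    then show "h (p_times B x y) = p_times (luk_plus N) (h x) (h y)"
      using ij by (simp add: x y positive_reduct_def luk_plus_def times hg)
  qed
  then show ?thesis by (auto simp: pmv_isomorphic_def)
qed

lemma chain_iso_luk: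
  assumes fin: "finite S" and nontriv: "\<zero>\<^sub>m \<noteq> \<one>\<^sub>m"
    and chain: "\<And>x y. \<lbrakk>x \<in> S; y \<in> S\<rbrakk> \<Longrightarrow> x \<sqsubseteq> y \<or> y \<sqsubseteq> x"
    and dich: "\<And>x y. \<lbrakk>x \<in> S; y \<in> S\<rbrakk> \<Longrightarrow> x \<oplus>\<^sub>m y = \<one>\<^sub>m \<or> x \<odot>\<^sub>m y = \<zero>\<^sub>m"
  shows "\<exists>n. n \<noteq> 0 \<and> pmv_isomorphic B (luk_plus n)"
proof -
  obtain a where a: "a \<in> S" "a \<noteq> \<zero>\<^sub>m" and a_le: "\<And>x. \<lbrakk>x \<in> S; x \<noteq> \<zero>\<^sub>m\<rbrakk> \<Longrightarrow> a \<sqsubseteq> x"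
  proof -
    have "\<exists>m\<in>S - {\<zero>\<^sub>m}. \<forall>x\<in>S - {\<zero>\<^sub>m}. m \<sqsubseteq> x"
      by (rule conjunct1[OF finite_chain_bounds])
        (use fin nontriv S_closed(2) chain in \<open>auto simp: S_carrier\<close>)
    then show thesis using that by auto
  qed
  obtain c where c: "c \<in> S" "c \<noteq> \<one>\<^sub>m" and le_c: "\<And>x. \<lbrakk>x \<in> S; x \<noteq> \<one>\<^sub>m\<rbrakk> \<Longrightarrow> x \<sqsubseteq> c"
  proof -
    have "\<exists>m\<in>S - {\<one>\<^sub>m}. \<forall>x\<in>S - {\<one>\<^sub>m}. x \<sqsubseteq> m"
      by (rule conjunct2[OF finite_chain_bounds])
        (use fin nontriv S_closed(1) chain in \<open>auto simp: S_carrier\<close>)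
    then show thesis using that by auto
  qed
  have aM: "a \<in> carrier M" and cM: "c \<in> carrier M" using a c by (auto simp: S_carrier)
  obtain n where n: "mult n a = \<one>\<^sub>m"
    using mult_reaches_one[OF fin _ S_closed(1) S_closed(5) dich a] S_carrier by blast
  \<comment> \<open>The image of \<open>S\<close> under negation exchanges \<open>\<oplus>\<close>
    and \<open>\<odot>\<close> and inherits the dichotomy, so \<open>mult_reaches_one\<close>
    applies to it. In terms of \<open>c\<close>, its powers reach 0.\<close>
  obtain n' where n': "mult n' (\<sim> c) = \<one>\<^sub>m"
  proof -
    have "\<sim> c \<noteq> \<zero>\<^sub>m" using c cM by (metis neg_neg neg_zero)
    moreover have "\<sim> x \<oplus>\<^sub>m \<sim> y \<in> mv_neg M ` S" if "x \<in> S" "y \<in> S" for x y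
      using that by (auto simp: neg_times S_carrier S_closed intro!: image_eqI[of _ _ "x \<odot>\<^sub>m y"])
    moreover have "\<sim> x \<oplus>\<^sub>m \<sim> y = \<one>\<^sub>m \<or> \<sim> x \<odot>\<^sub>m \<sim> y = \<zero>\<^sub>m" if "x \<in> S" "y \<in> S" for x y
      using that dich[of x y] by (auto simp: S_carrier simp flip: neg_times neg_plus)
    moreover have "\<zero>\<^sub>m \<in> mv_neg M ` S"
      using S_closed(2) by (metis image_eqI neg_one)
    ultimately have "\<exists>n. mult n (\<sim> c) = \<one>\<^sub>m"
      using fin c by (intro mult_reaches_one[of "mv_neg M ` S"]) (auto simp: S_carrier)
    then show thesis using that by auto
  qed
  have "a \<odot>\<^sub>m c = \<zero>\<^sub>m"
  proof (rule ccontr)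
    assume "a \<odot>\<^sub>m c \<noteq> \<zero>\<^sub>m"
    \<comment> \<open>Being nonzero, \<open>a \<odot> c\<close> is at least \<open>a\<close>.
      Dually, \<open>\<sim> a\<close> absorbs \<open>\<sim> c\<close> and therefore all its
      multiples, 1 included.\<close>
    then have "a \<odot>\<^sub>m c = a" using a c aM cM a_le by (intro le_antisym) (auto simp: S_closed)
    then have "\<sim> a \<oplus>\<^sub>m \<sim> c = \<sim> a" using neg_times[OF aM cM] by simp
    then have "\<sim> a \<oplus>\<^sub>m mult n' (\<sim> c) = \<sim> a" using aM cM by (intro plus_mult_absorb) simp_all
    then have "\<sim> a = \<one>\<^sub>m" using n' aM by simp
    then have "a = \<zero>\<^sub>m" using aM neg_neg[of a] by simp
    then show False using a by simp
  qed
  then have "c \<sqsubseteq> \<sim> a" using aM cM by (simp add: times_comm[of a] times_eq_zero_iff)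
  moreover have "a \<oplus>\<^sub>m c = \<one>\<^sub>m"
  proof (rule ccontr)
    assume "a \<oplus>\<^sub>m c \<noteq> \<one>\<^sub>m"
    \<comment> \<open>Differing from 1, the sum is at most \<open>c\<close>; so \<open>c\<close>
      absorbs \<open>a\<close> and all its multiples, 1 included.\<close>
    then have "a \<oplus>\<^sub>m c = c" using a c aM cM le_c by (intro le_antisym) (auto simp: S_closed)
    then have "c \<oplus>\<^sub>m mult n a = c"
      using aM cM by (intro plus_mult_absorb) (simp_all add: plus_comm)
    then have "c = \<one>\<^sub>m" using n cM by simp
    then show False using c by simp
  qed
  then have "\<sim> a \<sqsubseteq> c" using aM cM by (simp add: plus_eq_one_iff)
  ultimately have c_eq: "c = \<sim> a" using aM cM by (intro le_antisym) auto

  define N where "N = (LEAST n. mult n a = \<one>\<^sub>m)"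
  have N: "mult N a = \<one>\<^sub>m" unfolding N_def using n by (rule LeastI)
  have less_N: "mult k a \<noteq> \<one>\<^sub>m" if "k < N" for k
    using that not_less_Least unfolding N_def by blast
  have N0: "N \<noteq> 0" using N nontriv by (metis mult.simps(1))
  have neg: "\<sim> (mult k a) = mult (N - k) a" if "k \<le> N" for k
    using that
  proof (induction k)
    case 0
    then show ?case by (simp add: N)
  next
    case (Suc k)
    let ?y = "mult (N - Suc k) a"
    have y: "?y \<in> S" "?y \<in> carrier M" using a aM by (auto simp: mult_S)
    \<comment> \<open>By minimality of \<open>N\<close> the multiple \<open>?y\<close> is not 1, so
      it lies below \<open>c\<close>, which is \<open>\<sim> a\<close>. Hence removing
      \<open>a\<close> from \<open>?y \<oplus> a\<close> gives back exactly
      \<open>?y\<close>.\<close>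
    have "?y \<sqsubseteq> \<sim> a" using Suc.prems le_c[of ?y] less_N[of "N - Suc k"] y c_eq by auto
    have "\<sim> (mult (Suc k) a) = mult (N - k) a \<odot>\<^sub>m \<sim> a"
      using Suc aM by (simp add: neg_plus)
    also have "N - k = Suc (N - Suc k)" using Suc.prems by simp
    also have "mult (Suc (N - Suc k)) a \<odot>\<^sub>m \<sim> a = mv_meet M (\<sim> a) ?y"
      using y aM by (simp add: meet_eq times_comm plus_comm)
    also have "\<dots> = ?y" using y aM \<open>?y \<sqsubseteq> \<sim> a\<close> by (simp add: join_of_le)
    finally show ?case .
  qed
  have inj: "inj_on (\<lambda>k. mult k a) {..N}"
  proof (rule linorder_inj_onI')
    fix i j assume ij: "i \<in> {..N}" "j \<in> {..N}" "i < j"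
    show "mult i a \<noteq> mult j a"
    proof
      assume "mult i a = mult j a"
      \<comment> \<open>Adding \<open>N - j\<close> further copies of \<open>a\<close> turns the
        right side into 1, so 1 would be reached before index \<open>N\<close>.\<close>
      then have "mult (i + (N - j)) a = mult (j + (N - j)) a" using aM by (simp add: mult_add)
      then show False using ij N less_N[of "i + (N - j)"] by simp
    qed
  qed
  have "x \<in> (\<lambda>k. mult k a) ` {..N}" if x: "x \<in> S" for x
  proof -
    have xM: "x \<in> carrier M" using x by (rule S_carrier)
    define k where "k = (LEAST k. x \<sqsubseteq> mult k a)"
    have ex: "x \<sqsubseteq> mult N a" using N xM by simp
    then have k: "x \<sqsubseteq> mult k a" unfolding k_def by (rule LeastI)
    have kN: "k \<le> N" unfolding k_def using ex by (rule Least_le)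
    have "x = mult k a"
    proof (cases k)
      case 0
      then show ?thesis using k xM le_zero by simp
    next
      case (Suc j)
      let ?y = "mult j a"
      have j: "\<not> x \<sqsubseteq> ?y" using Suc not_less_Least[of j "\<lambda>k. x \<sqsubseteq> mult k a"] by (simp add: k_def)
      have y: "?y \<in> S" "?y \<in> carrier M" using a aM by (auto simp: mult_S)
      have yx: "?y \<sqsubseteq> x" using chain[OF x y(1)] j by simp
      \<comment> \<open>The complement of \<open>?y\<close> is again a multiple of \<open>a\<close>,
        so the difference stays in \<open>S\<close>, which is given as closed under the positive
        operations only. It is nonzero, hence at least \<open>a\<close>, and the choice of
        \<open>k\<close> makes it at most \<open>a\<close>.\<close>
      have "x \<odot>\<^sub>m \<sim> ?y \<in> S" using neg[of j] Suc kN x a by (auto simp: mult_S S_closed)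
      moreover have "x \<odot>\<^sub>m \<sim> ?y \<noteq> \<zero>\<^sub>m" using j xM y by (simp add: times_eq_zero_iff)
      ultimately have "a \<sqsubseteq> x \<odot>\<^sub>m \<sim> ?y" by (rule a_le)
      moreover have "x \<odot>\<^sub>m \<sim> ?y \<sqsubseteq> a" using k Suc xM y aM by (simp add: residuation)
      ultimately have d: "x \<odot>\<^sub>m \<sim> ?y = a" using xM y aM by (intro le_antisym) auto
      have "x = mv_join M x ?y" using yx xM y by (simp add: join_of_le)
      also have "\<dots> = mult k a" using d Suc aM y by (simp add: mv_join_def plus_comm)
      finally show ?thesis .
    qed
    then show ?thesis using kN by auto
  qed
  then have "S = (\<lambda>k. mult k a) ` {..N}" using a by (auto simp: mult_S)
  then show ?thesis using multiples_iso_luk[OF aM N0 neg inj] N0 by blast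
qed

end

subsection \<open>Invariance under isomorphism\<close>

text \<open>The inverse bijection cancels \<open>h\<close> only on the carrier, so \<open>A\<close>
  must contain its constants and the results of its operations.\<close>

lemma pmv_isomorphic_sym:
  assumes A: "pmv_structure A" and "pmv_isomorphic A B"
  shows "pmv_isomorphic B A"
proof -
  obtain h where h: "h \<in> pmv_iso A B" using assms by (auto simp: pmv_isomorphic_def)
  let ?g = "inv_into (carrier A) h"
  have bij: "bij_betw h (carrier A) (carrier B)" using h by (simp add: pmv_iso_def)
  have gh: "?g (h x) = x" if "x \<in> carrier A" for x
    using bij that by (rule bij_betw_inv_into_left)
  have B: "carrier B = h ` carrier A" using bij by (simp add: bij_betw_def)
  have "?g \<in> pmv_iso B A"
    unfolding pmv_iso_def
  proof (intro CollectI conjI ballI)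
    show "bij_betw ?g (carrier B) (carrier A)" using bij by (rule bij_betw_inv_into)
    show "?g (p_zero B) = p_zero A" "?g (p_one B) = p_one A"
      using h A gh[of "p_zero A"] gh[of "p_one A"]
      by (auto simp: pmv_iso_def pmv_structure_def pmv_subuniverse_def)
    fix x y assume "x \<in> carrier B" "y \<in> carrier B"
    then obtain x' y' where xy: "x' \<in> carrier A" "y' \<in> carrier A" "x = h x'" "y = h y'"
      using B by auto
    show "?g (p_join B x y) = p_join A (?g x) (?g y)" "?g (p_meet B x y) = p_meet A (?g x) (?g y)"
      "?g (p_plus B x y) = p_plus A (?g x) (?g y)" "?g (p_times B x y) = p_times A (?g x) (?g y)"
      using h A xy gh[of "p_join A x' y'"] gh[of "p_meet A x' y'"] gh[of "p_plus A x' y'"]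
        gh[of "p_times A x' y'"] gh
      by (simp_all add: pmv_iso_def pmv_structure_def pmv_subuniverse_def)
  qed
  then show ?thesis by (auto simp: pmv_isomorphic_def)
qed

lemma pmv_isomorphic_trans:
  assumes "pmv_isomorphic A B" "pmv_isomorphic B C"
  shows "pmv_isomorphic A C"
proof -
  obtain g h where g: "g \<in> pmv_iso A B" and h: "h \<in> pmv_iso B C"
    using assms by (auto simp: pmv_isomorphic_def)
  have "g x \<in> carrier B" if "x \<in> carrier A" for x
    using g that by (auto simp: pmv_iso_def bij_betw_def)
  then have "h \<circ> g \<in> pmv_iso A C"
    using g h by (auto simp: pmv_iso_def intro: bij_betw_trans)
  then show ?thesis by (auto simp: pmv_isomorphic_def)
qed

lemma pmv_structure_iso:
  assumes A: "pmv_structure A" and "pmv_isomorphic A B"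
  shows "pmv_structure B"
proof -
  obtain h where h: "h \<in> pmv_iso A B" using assms by (auto simp: pmv_isomorphic_def)
  then have B: "carrier B = h ` carrier A" by (simp add: pmv_iso_def bij_betw_def)
  have ops: "p_zero B = h (p_zero A)" "p_one B = h (p_one A)"
    "\<And>x y. \<lbrakk>x \<in> carrier A; y \<in> carrier A\<rbrakk> \<Longrightarrow> p_join B (h x) (h y) = h (p_join A x y)"
    "\<And>x y. \<lbrakk>x \<in> carrier A; y \<in> carrier A\<rbrakk> \<Longrightarrow> p_meet B (h x) (h y) = h (p_meet A x y)"
    "\<And>x y. \<lbrakk>x \<in> carrier A; y \<in> carrier A\<rbrakk> \<Longrightarrow> p_plus B (h x) (h y) = h (p_plus A x y)"
    "\<And>x y. \<lbrakk>x \<in> carrier A; y \<in> carrier A\<rbrakk> \<Longrightarrow> p_times B (h x) (h y) = h (p_times A x y)"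
    using h by (simp_all add: pmv_iso_def)
  show ?thesis
    using A unfolding pmv_structure_def pmv_subuniverse_def B by (simp add: ops)
qed

lemma luk_chain_iso:
  assumes "pmv_isomorphic A B" "luk_chain A"
  shows "luk_chain B"
proof -
  obtain h where h: "h \<in> pmv_iso A B" using assms by (auto simp: pmv_isomorphic_def)
  then have B: "carrier B = h ` carrier A" and inj: "inj_on h (carrier A)"
    by (auto simp: pmv_iso_def bij_betw_def)
  have "pmv_nontrivial B"
    using assms(2) inj unfolding luk_chain_def pmv_nontrivial_def B by (auto dest: inj_onD)
  moreover have "pmv_totally_ordered B"
    using assms(2) h unfolding luk_chain_def pmv_totally_ordered_def pmv_le_def B
    by (auto simp: pmv_iso_def) metis
  moreover have "\<forall>x\<in>carrier B. \<forall>y\<in>carrier B. p_plus B x y = p_one B \<or> p_times B x y = p_zero B"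
    using assms(2) h unfolding luk_chain_def B by (auto simp: pmv_iso_def) metis
  ultimately show ?thesis by (simp add: luk_chain_def)
qed

lemma pmv_congruence_ops:
  assumes "pmv_congruence A \<theta>" "(x, x') \<in> \<theta>" "(y, y') \<in> \<theta>"
  shows "(p_join A x y, p_join A x' y') \<in> \<theta>" "(p_meet A x y, p_meet A x' y') \<in> \<theta>"
    "(p_plus A x y, p_plus A x' y') \<in> \<theta>" "(p_times A x y, p_times A x' y') \<in> \<theta>"
  using assms unfolding pmv_congruence_def by fast+

lemma pmv_congruence_vimage:
  assumes A: "pmv_structure A" and h: "h \<in> pmv_iso A B" and \<theta>: "pmv_congruence B \<theta>"
  shows "pmv_congruence A {(x, y). x \<in> carrier A \<and> y \<in> carrier A \<and> (h x, h y) \<in> \<theta>}"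
    (is "pmv_congruence A ?\<theta>")
proof -
  have eq: "equiv (carrier B) \<theta>" using \<theta> by (simp add: pmv_congruence_def)
  have hB: "h x \<in> carrier B" if "x \<in> carrier A" for x
    using h that by (auto simp: pmv_iso_def bij_betw_def)
  have "equiv (carrier A) ?\<theta>"
    using equivE[OF eq] hB
    by (intro equivI) (auto simp: refl_on_def intro!: symI transI dest: symD transD)
  moreover have "\<forall>(x, x')\<in>?\<theta>. \<forall>(y, y')\<in>?\<theta>.
      (p_join A x y, p_join A x' y') \<in> ?\<theta> \<and> (p_meet A x y, p_meet A x' y') \<in> ?\<theta> \<and>
      (p_plus A x y, p_plus A x' y') \<in> ?\<theta> \<and> (p_times A x y, p_times A x' y') \<in> ?\<theta>"
    using A h by (auto simp: pmv_iso_def pmv_structure_def pmv_subuniverse_def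
        intro: pmv_congruence_ops[OF \<theta>])
  ultimately show ?thesis unfolding pmv_congruence_def by (rule conjI)
qed

text \<open>A family of congruences on \<open>B\<close> is pulled back along \<open>h\<close>;
  pulling back commutes with meets and, by injectivity, preserves the identity. Surjectivity shows
  that a congruence whose pullback is the identity is itself the identity.\<close>

lemma pmv_subdirectly_irreducible_iso:
  assumes A: "pmv_structure A" and iso: "pmv_isomorphic A B" and irr: "pmv_subdirectly_irreducible A"
  shows "pmv_subdirectly_irreducible B"
  unfolding pmv_subdirectly_irreducible_def
proof (intro allI impI)
  fix \<Theta> assume \<Theta>: "(\<forall>\<theta>\<in>\<Theta>. pmv_congruence B \<theta>) \<and>
    carrier B \<times> carrier B \<inter> \<Inter>\<Theta> = Id_on (carrier B)"
  obtain h where h: "h \<in> pmv_iso A B" using iso by (auto simp: pmv_isomorphic_def)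
  then have B: "carrier B = h ` carrier A" and inj: "inj_on h (carrier A)"
    by (auto simp: pmv_iso_def bij_betw_def)
  let ?f = "\<lambda>\<theta>. {(x, y). x \<in> carrier A \<and> y \<in> carrier A \<and> (h x, h y) \<in> \<theta>}"
  have "\<forall>\<theta>\<in>\<Theta>. pmv_congruence A (?f \<theta>)" using \<Theta> pmv_congruence_vimage[OF A h] by blast
  \<comment> \<open>Intersecting with the full relation makes the equation cover the empty family as
    well.\<close>
  moreover have "carrier A \<times> carrier A \<inter> \<Inter>(?f ` \<Theta>) = ?f (carrier B \<times> carrier B \<inter> \<Inter>\<Theta>)"
    using B by auto
  moreover have "\<dots> = Id_on (carrier A)"
    using \<Theta> B inj by (auto simp: Id_on_iff dest: inj_onD)
  ultimately have "Id_on (carrier A) \<in> ?f ` \<Theta>"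
    by (intro pmv_subdirectly_irreducibleD[OF irr]) simp_all
  then obtain \<theta> where \<theta>: "\<theta> \<in> \<Theta>" "?f \<theta> = Id_on (carrier A)" by auto
  have eq: "equiv (carrier B) \<theta>" using \<Theta> \<theta> by (simp add: pmv_congruence_def)
  then have sub: "\<theta> \<subseteq> carrier B \<times> carrier B" by (simp add: equiv_def)
  have "p = q" if pq: "(p, q) \<in> \<theta>" for p q
  proof -
    obtain x y where xy: "x \<in> carrier A" "y \<in> carrier A" "p = h x" "q = h y"
      using pq sub B by blast
    then have "(x, y) \<in> Id_on (carrier A)" using \<theta>(2) pq by blast
    then show ?thesis using xy by (simp add: Id_on_iff)
  qed
  then have "\<theta> = Id_on (carrier B)" using eq sub by (auto simp: equiv_def refl_on_def Id_on_iff)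
  then show "Id_on (carrier B) \<in> \<Theta>" using \<theta> by simp
qed

subsection \<open>Finite Lukasiewicz chains\<close>

lemma luk_plus_luk_chain:
  assumes "n \<noteq> 0"
  shows "luk_chain (luk_plus n)"
proof -
  have "0 \<in> carrier (luk_plus n)" "1 \<in> carrier (luk_plus n)"
    using assms by (auto simp: luk_plus_def intro: exI[of _ 0] exI[of _ n])
  then have "pmv_nontrivial (luk_plus n)" unfolding pmv_nontrivial_def by (metis zero_neq_one)
  then show ?thesis
    by (auto simp: luk_chain_def pmv_totally_ordered_def pmv_le_def luk_plus_def min_def max_def)
qed

text \<open>Simplicity: from \<open>p < q\<close> one gets \<open>(p + (1 - q), 1) \<in> \<theta>\<close>, and powers of an element
  below 1 reach 0.\<close>

lemma luk_plus_simple: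
  assumes n: "n \<noteq> 0" and \<theta>: "pmv_congruence (luk_plus n) \<theta>"
    and pq: "(p, q) \<in> \<theta>" "p < q"
  shows "\<theta> = carrier (luk_plus n) \<times> carrier (luk_plus n)"
proof -
  let ?L = "carrier (luk_plus n)"
  have eq: "equiv ?L \<theta>" using \<theta> by (simp add: pmv_congruence_def)
  have sub: "\<theta> \<subseteq> ?L \<times> ?L" and refl: "\<And>x. x \<in> ?L \<Longrightarrow> (x, x) \<in> \<theta>"
    and sym: "\<And>x y. (x, y) \<in> \<theta> \<Longrightarrow> (y, x) \<in> \<theta>"
    and trans: "\<And>x y z. (x, y) \<in> \<theta> \<Longrightarrow> (y, z) \<in> \<theta> \<Longrightarrow> (x, z) \<in> \<theta>"
    using eq by (auto simp: equiv_def refl_on_def dest: symD transD)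
  have L: "?L = {real k / real n | k. k \<le> n}" by (simp add: luk_plus_def)
  have ops: "(min x y, min x' y') \<in> \<theta>" "(min (x + y) 1, min (x' + y') 1) \<in> \<theta>"
    "(max (x + y - 1) 0, max (x' + y' - 1) 0) \<in> \<theta>"
    if "(x, x') \<in> \<theta>" "(y, y') \<in> \<theta>" for x x' y y'
    using pmv_congruence_ops[OF \<theta> that] by (simp_all add: luk_plus_def)
  obtain k where k: "k \<le> n" "q = real k / real n" using pq sub L by auto
  have "1 - q = real (n - k) / real n" using k n by (simp add: of_nat_diff field_simps)
  then have "1 - q \<in> ?L" using L by force
  then have "(min (p + (1 - q)) 1, min (q + (1 - q)) 1) \<in> \<theta>" using pq refl by (intro ops) auto
  then have d: "(1 - (q - p), 1) \<in> \<theta>" using pq by (simp add: algebra_simps)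
  have pow: "(max (1 - real m * (q - p)) 0, 1) \<in> \<theta>" for m
  proof (induction m)
    case 0
    then show ?case using refl[of 1] L n by (force intro: exI[of _ n])
  next
    case (Suc m)
    \<comment> \<open>Since \<open>q - p\<close> is positive, a value already truncated to 0 stays
      at 0.\<close>
    have "max (max (1 - real m * (q - p)) 0 + (1 - (q - p)) - 1) 0 = max (1 - real (Suc m) * (q - p)) 0"
      using pq by (auto simp: max_def algebra_simps)
    then show ?case using ops(3)[OF Suc d] by simp
  qed
  obtain m where "1 < real m * (q - p)" using pq reals_Archimedean3[of "q - p"] by auto
  then have "(0, 1) \<in> \<theta>" using pow[of m] by (simp add: max_def)
  \<comment> \<open>Meeting \<open>x\<close> with the related elements 0 and 1 gives 0 and
    \<open>x\<close>, so every element is related to 0.\<close>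
  then have "(0, x) \<in> \<theta>" if "x \<in> ?L" for x
  proof -
    have "0 \<le> x" "x \<le> 1" using that L n by auto
    then show ?thesis using ops(1)[OF refl[OF that] \<open>(0, 1) \<in> \<theta>\<close>] by (simp add: min.absorb1 min.absorb2)
  qed
  then show ?thesis using sub sym trans by blast
qed

text \<open>By simplicity a congruence is either full or the identity. As the algebra is nontrivial,
  a family meeting in the identity has a member that is not full.\<close>

lemma luk_plus_subdirectly_irreducible:
  assumes n: "n \<noteq> 0"
  shows "pmv_subdirectly_irreducible (luk_plus n)"
  unfolding pmv_subdirectly_irreducible_def
proof (intro allI impI)
  let ?L = "carrier (luk_plus n)"
  fix \<Theta> assume \<Theta>: "(\<forall>\<theta>\<in>\<Theta>. pmv_congruence (luk_plus n) \<theta>) \<and> ?L \<times> ?L \<inter> \<Inter>\<Theta> = Id_on ?L"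
  obtain x y where "x \<in> ?L" "y \<in> ?L" "x \<noteq> y"
    using luk_plus_luk_chain[OF n] by (auto simp: luk_chain_def pmv_nontrivial_def)
  then have "?L \<times> ?L \<noteq> Id_on ?L" by (auto simp: Id_on_iff set_eq_iff)
  then have "\<not> ?L \<times> ?L \<subseteq> \<Inter>\<Theta>" using \<Theta> by (metis Int_absorb2)
  then obtain \<theta> where \<theta>: "\<theta> \<in> \<Theta>" "\<theta> \<noteq> ?L \<times> ?L" by blast
  have cong: "pmv_congruence (luk_plus n) \<theta>" using \<theta> \<Theta> by blast
  then have eq: "equiv ?L \<theta>" by (simp add: pmv_congruence_def)
  have "p = q" if "(p, q) \<in> \<theta>" for p q
    using luk_plus_simple[OF n cong, of p q] luk_plus_simple[OF n cong, of q p] \<theta>(2) that eq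
    by (metis equiv_def linorder_neqE_linordered_idom symD)
  then have "\<theta> = Id_on ?L" using eq by (auto simp: equiv_def refl_on_def Id_on_iff)
  then show "Id_on ?L \<in> \<Theta>" using \<theta> by simp
qed

text \<open>The empty family of congruences has the full relation as its meet; on a trivial carrier
  this is the identity, which the empty family does not contain.\<close>

lemma pmv_subdirectly_irreducible_nontrivial:
  assumes "pmv_subdirectly_irreducible A"
  shows "pmv_nontrivial A"
proof (rule ccontr)
  assume "\<not> pmv_nontrivial A"
  then have "carrier A \<times> carrier A = Id_on (carrier A)"
    by (auto simp: pmv_nontrivial_def Id_on_iff)
  then show False using pmv_subdirectly_irreducibleD[OF assms, of "{}"] by simp
qed

subsection \<open>The equivalence\<close>

context positive_subreduct
begin

lemma luk_chain_if_irreducible: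
  assumes "pmv_subdirectly_irreducible B"
  shows "luk_chain B"
  using assms irreducible_le irreducible_dichotomy pmv_subdirectly_irreducible_nontrivial[of B]
  unfolding luk_chain_def pmv_totally_ordered_def
  by (simp add: pmv_le_iff) (simp add: positive_reduct_def)

lemma luk_chain_iso_luk:
  assumes fin: "finite S" and chain: "luk_chain B"
  shows "\<exists>n. n \<noteq> 0 \<and> pmv_isomorphic B (luk_plus n)"
proof (rule chain_iso_luk[OF fin])
  show "\<zero>\<^sub>m \<noteq> \<one>\<^sub>m"
  proof
    assume eq: "\<zero>\<^sub>m = \<one>\<^sub>m"
    \<comment> \<open>If 0 and 1 coincide, every element lies below 0, so \<open>S\<close> has a
      single element.\<close>
    have "x = \<zero>\<^sub>m" if "x \<in> S" for x
      using le_one[of x] le_zero[of x] S_carrier[OF that] by (simp add: eq)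
    then show False using chain by (auto simp: luk_chain_def pmv_nontrivial_def)
  qed
  fix x y assume "x \<in> S" "y \<in> S"
  then show "x \<sqsubseteq> y \<or> y \<sqsubseteq> x"
    using chain by (auto simp: luk_chain_def pmv_totally_ordered_def pmv_le_iff)
  show "x \<oplus>\<^sub>m y = \<one>\<^sub>m \<or> x \<odot>\<^sub>m y = \<zero>\<^sub>m"
    using chain \<open>x \<in> S\<close> \<open>y \<in> S\<close> by (auto simp: luk_chain_def positive_reduct_def)
qed

end

theorem theorem6p6:
  fixes A :: "'a pmv"
  assumes "positive_mv_algebra TYPE('b) A"
    and "finite (carrier A)"
  shows "(pmv_subdirectly_irreducible A \<longleftrightarrow> (\<exists>n. n \<noteq> 0 \<and> pmv_isomorphic A (luk_plus n)))
    \<and> ((\<exists>n. n \<noteq> 0 \<and> pmv_isomorphic A (luk_plus n)) \<longleftrightarrow>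
        pmv_nontrivial A \<and> pmv_totally_ordered A \<and>
        (\<forall>x\<in>carrier A. \<forall>y\<in>carrier A. p_plus A x y = p_one A \<or> p_times A x y = p_zero A))"
proof -
  have struct: "pmv_structure A" using assms by (simp add: positive_mv_algebra_def)
  obtain M :: "'b mv" and S where M: "mv_algebra M" "pmv_subuniverse S (positive_reduct M)"
    and iso: "pmv_isomorphic A ((positive_reduct M)\<lparr>carrier := S\<rparr>)"
    using assms by (auto simp: positive_mv_algebra_def)
  interpret positive_subreduct M S
    using M by (simp add: positive_subreduct_def positive_subreduct_axioms_def)
  have fin: "finite S"
    using iso assms(2) bij_betw_finite
    by (fastforce simp: pmv_isomorphic_def pmv_iso_def)
  have iso': "pmv_isomorphic B A" using struct iso by (rule pmv_isomorphic_sym)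
  \<comment> \<open>The implications run from (1) to (3) to (2), and from (2) back to both others.
    The first two are proved in the subreduct \<open>B\<close> and carried over to
    \<open>A\<close>.\<close>
  have one_three: "luk_chain A" if "pmv_subdirectly_irreducible A"
  proof -
    have "pmv_subdirectly_irreducible B"
      using struct iso that by (rule pmv_subdirectly_irreducible_iso)
    then have "luk_chain B" by (rule luk_chain_if_irreducible)
    then show ?thesis using iso' luk_chain_iso by blast
  qed
  have three_two: "\<exists>n. n \<noteq> 0 \<and> pmv_isomorphic A (luk_plus n)" if "luk_chain A"
  proof -
    have "luk_chain B" using iso that by (rule luk_chain_iso)
    then show ?thesis using luk_chain_iso_luk[OF fin] pmv_isomorphic_trans[OF iso] by blast
  qed
  have two_one: "pmv_subdirectly_irreducible A" and two_three: "luk_chain A"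
    if n: "n \<noteq> 0" "pmv_isomorphic A (luk_plus n)" for n
  proof -
    have "pmv_isomorphic (luk_plus n) A" using struct n(2) by (rule pmv_isomorphic_sym)
    then show "luk_chain A" using luk_chain_iso luk_plus_luk_chain n by blast
  next
    show "pmv_subdirectly_irreducible A"
      using pmv_structure_iso[OF struct n(2)] pmv_isomorphic_sym[OF struct n(2)]
        luk_plus_subdirectly_irreducible[OF n(1)]
      by (rule pmv_subdirectly_irreducible_iso)
  qed
  show ?thesis
    using one_three two_one two_three three_two unfolding luk_chain_def by blast
qed

end
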